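(* For every integer $N\ge 1$, the function $F=F(t,x)=\frac{1}{1-2tx+t^{2}}$ is a solution of the nonlinear differential equation $$2^{N}N!\,F^{N+1}=\sum_{i=1}^{N}a_{i}(N)\,(x-t)^{i-2N}F^{(i)}$$ (at all points $(t,x)$ with $t\neq x$ and $1-2tx+t^2\neq 0$), where $F^{N+1}$ is the $(N+1)$-st power of $F$, $F^{(i)}=\left(\frac{d}{dt}\right)^{i}F(t,x)$ is the $i$-th derivative with respect to $t$, and the coefficients are $$a_{1}(N)=(2N-3)!!,$$ and, for $2\le i\le N$, $$a_{i}(N)=\sum_{k_{i-1}=0}^{N-i}\ \sum_{k_{i-2}=0}^{N-i-k_{i-1}}\cdots\sum_{k_{1}=0}^{N-i-k_{i-1}-\cdots-k_{2}}2^{\sum_{j=1}^{i-1}k_{j}}\left[\prod_{j=2}^{i}\left(N-\sum_{l=j}^{i-1}k_{l}-\frac{2i+2-j}{2}\right)_{k_{j-1}}\right]\left(2\left(N-i-\sum_{j=1}^{i-1}k_{j}\right)-1\right)!!.$$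
   Context: For a number $y$ and integer $n\ge1$, $(y)_{n}=y(y-1)\cdots(y-n+1)$ is the falling factorial, and $(y)_{0}=1$. The double factorial is $(2k-1)!!=(2k-1)(2k-3)\cdots 3\cdot 1$ for $k\ge1$, with the convention $(-1)!!=1$. Empty sums are $0$. *)

theory Defs
  imports "HOL-Analysis.Analysis"
begin

definition falling_fact :: "'a::comm_ring_1 \<Rightarrow> nat \<Rightarrow> 'a" where
  "falling_fact y n = (\<Prod>k<n. y - of_nat k)"

text \<open>The double factorial $(2k-1)!!$ of an odd number, indexed by $k$;
  the empty product gives the convention $(-1)!! = 1$.\<close>

definition odd_double_fact :: "nat \<Rightarrow> nat" where
  "odd_double_fact k = (\<Prod>j=1..k. 2 * j - 1)"

text \<open>\<open>nested_sum m M g k\<close> is the iterated sum over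
  $k_m = 0,\dots,M$, then $k_{m-1} = 0,\dots,M-k_m$, and so on down to
  $k_1 = 0,\dots,M-k_m-\cdots-k_2$, of \<open>g\<close> applied to the index function,
  where \<open>k\<close> supplies the values outside $1,\dots,m$. The natural-number
  subtraction never truncates, since $c \le M$.\<close>

fun nested_sum :: "nat \<Rightarrow> nat \<Rightarrow> ((nat \<Rightarrow> nat) \<Rightarrow> 'a) \<Rightarrow> (nat \<Rightarrow> nat) \<Rightarrow> 'a::comm_monoid_add" where
  "nested_sum 0 M g k = g k"
| "nested_sum (Suc m) M g k = (\<Sum>c=0..M. nested_sum m (M - c) g (k(Suc m := c)))"

text \<open>The coefficient $a_i(N)$, intended for $1 \le i \le N$. For \<open>i = 1\<close> it is
  $(2N-3)!! = (2(N-1)-1)!!$. In the other case $k_1 + \cdots + k_{i-1} \le N - i$ holds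
  in every summand, so no natural-number subtraction truncates.\<close>

definition coeff_a :: "nat \<Rightarrow> nat \<Rightarrow> 'a::field" where
  "coeff_a N i =
    (if i = 1 then of_nat (odd_double_fact (N - 1))
     else nested_sum (i - 1) (N - i)
       (\<lambda>k. 2 ^ (\<Sum>j=1..i-1. k j)
          * (\<Prod>j=2..i. falling_fact
               (of_nat N - of_nat (\<Sum>l=j..i-1. k l) - (2 * of_nat i + 2 - of_nat j) / 2)
               (k (j - 1)))
          * of_nat (odd_double_fact (N - i - (\<Sum>j=1..i-1. k j))))
       (\<lambda>_. 0))"

definition F :: "'a::field \<Rightarrow> 'a \<Rightarrow> 'a" where
  "F t x = 1 / (1 - 2 * t * x + t\<^sup>2)"

end

theory Submission
  imports Defs "HOL-Computational_Algebra.Polynomial"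
begin

text \<open>Since \<open>F' = 2 (x - t) F\<^sup>2\<close>, differentiating the equation for \<open>N\<close> and dividing by
  \<open>x - t\<close> yields the equation for \<open>N + 1\<close> as soon as
  \<open>a\<^sub>i(N + 1) = (2 N - i) a\<^sub>i(N) + a\<^sub>i\<^sub>-\<^sub>1(N)\<close>, with \<open>a\<^sub>0(N) = a\<^sub>N\<^sub>+\<^sub>1(N) = 0\<close>.
  Isolating the outermost sum over \<open>k\<^sub>i\<^sub>-\<^sub>1 = c\<close> in the definition of \<open>a\<^sub>i(N)\<close> gives
  \<open>a\<^sub>i(N) = \<Sum>c. 2\<^sup>c (N - (i + 2) / 2)\<^sub>c a\<^sub>i\<^sub>-\<^sub>1(N - c - 1)\<close>, and splitting off \<open>c = 0\<close> in turn
  gives this recurrence.\<close>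

section \<open>Recurrence for the coefficients\<close>

lemma falling_fact_Suc: "falling_fact y (Suc n) = y * falling_fact (y - 1) n"
  unfolding falling_fact_def by (subst prod.lessThan_Suc_shift) (simp add: algebra_simps)

lemma odd_double_fact_Suc: "odd_double_fact (Suc k) = (2 * k + 1) * odd_double_fact k"
  by (simp add: odd_double_fact_def)

text \<open>Summation changes only the positions \<open>1..m\<close>, so the summands need comparing
  only on index functions that agree there and keep the values of \<open>k\<close> and
  \<open>k'\<close> elsewhere. Letting \<open>k\<close> and \<open>k'\<close> differ allows one side
  to store a fixed outer index that the other side lacks.\<close>

lemma nested_sum_cong_scaled:
  fixes g h :: "(nat \<Rightarrow> nat) \<Rightarrow> 'a::comm_semiring_0"
  assumes "\<And>p q. \<lbrakk>\<And>j. j \<in> {1..m} \<Longrightarrow> p j = q j; \<And>j. j \<notin> {1..m} \<Longrightarrow> p j = k j;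
                  \<And>j. j \<notin> {1..m} \<Longrightarrow> q j = k' j\<rbrakk> \<Longrightarrow> g p = c * h q"
  shows "nested_sum m M g k = c * nested_sum m M h k'"
  using assms
proof (induction m arbitrary: M k k')
  case 0
  then show ?case by simp
next
  case (Suc m)
  have "nested_sum m (M - d) g (k(Suc m := d)) = c * nested_sum m (M - d) h (k'(Suc m := d))" for d
  proof (rule Suc.IH)
    fix p q
    assume eq: "\<And>j. j \<in> {1..m} \<Longrightarrow> p j = q j"
      and p: "\<And>j. j \<notin> {1..m} \<Longrightarrow> p j = (k(Suc m := d)) j"
      and q: "\<And>j. j \<notin> {1..m} \<Longrightarrow> q j = (k'(Suc m := d)) j"
    show "g p = c * h q"
    proof (rule Suc.prems)
      show "p j = q j" if "j \<in> {1..Suc m}" for j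
        using that eq[of j] p[of j] q[of j] by (cases "j = Suc m") auto
      show "p j = k j" if "j \<notin> {1..Suc m}" for j
        using that p[of j] by auto
      show "q j = k' j" if "j \<notin> {1..Suc m}" for j
        using that q[of j] by auto
    qed
  qed
  then show ?case by (simp add: sum_distrib_left)
qed

definition coeff_summand :: "nat \<Rightarrow> nat \<Rightarrow> (nat \<Rightarrow> nat) \<Rightarrow> 'a::field" where
  "coeff_summand N i k = 2 ^ (\<Sum>j=1..i-1. k j)
     * (\<Prod>j=2..i. falling_fact
          (of_nat N - of_nat (\<Sum>l=j..i-1. k l) - (2 * of_nat i + 2 - of_nat j) / 2)
          (k (j - 1)))
     * of_nat (odd_double_fact (N - i - (\<Sum>j=1..i-1. k j)))"

text \<open>For \<open>i = 1\<close> the nesting has depth 0 and the sum and product in the summand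
  are empty, which leaves \<open>odd_double_fact (N - 1)\<close>; the case distinction in
  \<open>coeff_a\<close> disappears.\<close>

lemma coeff_a_eq_nested_sum:
  "i \<ge> 1 \<Longrightarrow> coeff_a N i = nested_sum (i - 1) (N - i) (coeff_summand N i) (\<lambda>_. 0)"
  by (auto simp: coeff_a_def coeff_summand_def[abs_def])

text \<open>With \<open>i = m + 2\<close> and the outermost index fixed to \<open>c\<close>, every
  tail sum with \<open>j < i\<close> contains \<open>c\<close>, while
  \<open>(2 * i + 2 - j) / 2\<close> exceeds its value for \<open>i - 1\<close> by 1. Replacing
  \<open>N\<close> by \<open>N - c - 1\<close> and \<open>i\<close> by \<open>i - 1\<close>
  therefore preserves these factors and the double factorial. The bound on \<open>N\<close> keeps
  \<open>N - c - 1\<close> from truncating.\<close>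

lemma coeff_summand_Suc:
  fixes p q :: "nat \<Rightarrow> nat"
  assumes "m + c + 2 \<le> N" and eq: "\<And>j. j \<in> {1..m} \<Longrightarrow> p j = q j" and c: "p (Suc m) = c"
  shows "(coeff_summand N (m + 2) p :: 'a::field_char_0) =
    2 ^ c * falling_fact (of_nat N - of_nat (m + 4) / 2) c * coeff_summand (N - c - 1) (m + 1) q"
proof -
  have tail: "(\<Sum>l=j..Suc m. p l) = c + (\<Sum>l=j..m. q l)" if "1 \<le> j" "j \<le> Suc m" for j
    using that eq c by (auto simp: sum.cl_ivl_Suc intro!: sum.cong)
  have fact_eq: "falling_fact
          (of_nat N - of_nat (\<Sum>l=j..Suc m. p l) - (2 * of_nat (m + 2) + 2 - of_nat j) / 2)
          (p (j - 1)) = (falling_fact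
          (of_nat (N - c - 1) - of_nat (\<Sum>l=j..m. q l) - (2 * of_nat (m + 1) + 2 - of_nat j) / 2)
          (q (j - 1)) :: 'a)" if j: "j \<in> {2..m + 1}" for j
  proof -
    have "of_nat (N - c - 1) = (of_nat N - of_nat c - 1 :: 'a)"
      using assms(1) by (simp add: of_nat_diff)
    moreover have "(\<Sum>l=j..Suc m. p l) = c + (\<Sum>l=j..m. q l)"
      using j by (intro tail) auto
    ultimately have
      "of_nat N - of_nat (\<Sum>l=j..Suc m. p l) - (2 * of_nat (m + 2) + 2 - of_nat j) / 2 =
       (of_nat (N - c - 1) - of_nat (\<Sum>l=j..m. q l) - (2 * of_nat (m + 1) + 2 - of_nat j) / 2 :: 'a)"
      by (simp only: of_nat_add) (simp add: field_simps)
    moreover have "p (j - 1) = q (j - 1)"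
      using j by (intro eq) auto
    ultimately show ?thesis by (simp only:)
  qed
  let ?A = "\<lambda>j. falling_fact
      (of_nat N - of_nat (\<Sum>l=j..Suc m. p l) - (2 * of_nat (m + 2) + 2 - of_nat j) / 2)
      (p (j - 1)) :: 'a"
  have "(\<Prod>j=2..m + 2. ?A j) = ?A (m + 2) * (\<Prod>j=2..m + 1. ?A j)"
    using prod.nat_ivl_Suc'[of 2 "m + 1" ?A] by simp
  also have "(\<Prod>j=2..m + 1. ?A j) = (\<Prod>j=2..m + 1. falling_fact
      (of_nat (N - c - 1) - of_nat (\<Sum>l=j..m. q l) - (2 * of_nat (m + 1) + 2 - of_nat j) / 2)
      (q (j - 1)))"
    by (rule prod.cong[OF refl fact_eq])
  \<comment> \<open>For \<open>j = i\<close> the tail sum is empty and \<open>2 * i + 2 - j\<close>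
    is \<open>i + 2\<close>.\<close>
  also have "?A (m + 2) = falling_fact (of_nat N - of_nat (m + 4) / 2) c"
  proof -
    have "(2 * of_nat (m + 2) + 2 - of_nat (m + 2) :: 'a) = of_nat (m + 4)"
      by (simp add: algebra_simps)
    then show ?thesis using c by (simp only:) simp
  qed
  finally have "(\<Prod>j=2..m + 2. ?A j) = falling_fact (of_nat N - of_nat (m + 4) / 2) c
      * (\<Prod>j=2..m + 1. falling_fact
      (of_nat (N - c - 1) - of_nat (\<Sum>l=j..m. q l) - (2 * of_nat (m + 1) + 2 - of_nat j) / 2)
      (q (j - 1)))" .
  moreover have "(\<Sum>j=1..Suc m. p j) = c + (\<Sum>j=1..m. q j)"
    by (intro tail) auto
  moreover have "N - (m + 2) - (c + s) = N - c - 1 - (m + 1) - s" for s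
    by simp
  ultimately show ?thesis
    by (simp add: coeff_summand_def power_add mult_ac)
qed

lemma coeff_a_unfold:
  assumes "2 \<le> i" "i \<le> N"
  shows "(coeff_a N i :: 'a::field_char_0) =
    (\<Sum>c=0..N - i. 2 ^ c * falling_fact (of_nat N - of_nat (i + 2) / 2) c
                     * coeff_a (N - c - 1) (i - 1))"
proof -
  obtain m where i: "i = m + 2"
    using assms(1) by (metis add.commute le_Suc_ex)
  have "nested_sum m (N - i - c) (coeff_summand N i) ((\<lambda>_. 0)(Suc m := c)) =
      2 ^ c * falling_fact (of_nat N - of_nat (i + 2) / 2) c * (coeff_a (N - c - 1) (i - 1) :: 'a)"
    if "c \<le> N - i" for c
  proof -
    have "nested_sum m (N - i - c) (coeff_summand N i) ((\<lambda>_. 0)(Suc m := c)) =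
      2 ^ c * falling_fact (of_nat N - of_nat (i + 2) / 2) c *
      (nested_sum m (N - i - c) (coeff_summand (N - c - 1) (i - 1)) (\<lambda>_. 0) :: 'a)"
    proof (rule nested_sum_cong_scaled)
      fix p q :: "nat \<Rightarrow> nat"
      assume "\<And>j. j \<in> {1..m} \<Longrightarrow> p j = q j"
        and p: "\<And>j. j \<notin> {1..m} \<Longrightarrow> p j = ((\<lambda>_. 0)(Suc m := c)) j"
      moreover have "p (Suc m) = c" using p[of "Suc m"] by simp
      ultimately show "(coeff_summand N i p :: 'a) =
        2 ^ c * falling_fact (of_nat N - of_nat (i + 2) / 2) c * coeff_summand (N - c - 1) (i - 1) q"
        using coeff_summand_Suc[where 'a = 'a, of m c N p q] that assms(2) i by (simp add: numeral_eq_Suc)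
    qed
    moreover have "N - c - 1 - (i - 1) = N - i - c"
      using i by simp
    ultimately show ?thesis
      using i by (simp add: coeff_a_eq_nested_sum)
  qed
  moreover have "coeff_a N i = (nested_sum (Suc m) (N - i) (coeff_summand N i) (\<lambda>_. 0) :: 'a)"
    using i coeff_a_eq_nested_sum[of i N] by simp
  ultimately show ?thesis
    unfolding nested_sum.simps by simp
qed

lemma coeff_a_Suc_1:
  "N \<ge> 1 \<Longrightarrow> (coeff_a (Suc N) 1 :: 'a::field) = (2 * of_nat N - 1) * coeff_a N 1"
  by (cases N) (simp_all add: coeff_a_def odd_double_fact_Suc algebra_simps)

text \<open>On the diagonal the unfolded sum has the single term \<open>c = 0\<close>, with weight
  1.\<close>

lemma coeff_a_diag: "N \<ge> 1 \<Longrightarrow> (coeff_a (Suc N) (Suc N) :: 'a::field_char_0) = coeff_a N N"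
  by (subst coeff_a_unfold) (auto simp: falling_fact_def)

lemma coeff_a_Suc:
  assumes "2 \<le> i" "i \<le> N"
  shows "(coeff_a (Suc N) i :: 'a::field_char_0) =
    (2 * of_nat N - of_nat i) * coeff_a N i + coeff_a N (i - 1)"
proof -
  \<comment> \<open>This is the argument of the falling factorial in the unfolding of
    \<open>coeff_a N i\<close>; for \<open>Suc N\<close> it becomes \<open>y + 1\<close>.\<close>
  define y :: 'a where "y = of_nat N - of_nat (i + 2) / 2"
  have "(coeff_a (Suc N) i :: 'a) =
    (\<Sum>c=0..Suc (N - i). 2 ^ c * falling_fact (y + 1) c * coeff_a (N - c) (i - 1))"
    using assms by (subst coeff_a_unfold) (auto simp: Suc_diff_le algebra_simps y_def)
  also have "\<dots> = coeff_a N (i - 1)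
      + (\<Sum>c=0..N - i. 2 ^ Suc c * falling_fact (y + 1) (Suc c) * coeff_a (N - Suc c) (i - 1))"
    by (subst sum.atLeast0_atMost_Suc_shift) (simp add: falling_fact_def)
  \<comment> \<open>Since \<open>falling_fact (y + 1) (Suc c) = (y + 1) * falling_fact y c\<close>,
    the factor \<open>2 * (y + 1)\<close> comes out and the unfolding of \<open>coeff_a N i\<close>
    remains.\<close>
  also have "(\<Sum>c=0..N - i. 2 ^ Suc c * falling_fact (y + 1) (Suc c) * coeff_a (N - Suc c) (i - 1))
      = 2 * (y + 1) * coeff_a N i"
    unfolding coeff_a_unfold[where 'a = 'a, OF assms, folded y_def] sum_distrib_left
    by (simp add: falling_fact_Suc mult_ac del: distrib_left_numeral distrib_right_numeral)
  also have "2 * (y + 1) = 2 * of_nat N - of_nat i"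
    by (simp add: y_def field_simps)
  finally show ?thesis by simp
qed

text \<open>Summed form of the recurrence, in the shape that differentiating the expansion for
  \<open>N\<close> produces.\<close>

lemma sum_coeff_a_Suc:
  fixes f :: "nat \<Rightarrow> 'a::field_char_0"
  assumes "N \<ge> 1"
  shows "(\<Sum>i=1..Suc N. coeff_a (Suc N) i * f i) =
    (\<Sum>i=1..N. coeff_a N i * ((2 * of_nat N - of_nat i) * f i + f (Suc i)))"
proof -
  \<comment> \<open>Cutting off to zero is essential: outside the intended range,
    \<open>coeff_a N 0\<close> and \<open>coeff_a N (Suc N)\<close> are nonzero by definition. With
    \<open>b\<close> one recurrence covers all of \<open>1..Suc N\<close>.\<close>
  define b :: "nat \<Rightarrow> 'a" where "b i = (if i \<in> {1..N} then coeff_a N i else 0)" for i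
  have rec: "coeff_a (Suc N) i = (2 * of_nat N - of_nat i) * b i + b (i - 1)"
    if "i \<in> {1..Suc N}" for i
  proof -
    consider "i = 1" | "2 \<le> i" "i \<le> N" | "i = Suc N"
      using \<open>i \<in> {1..Suc N}\<close> by fastforce
    then show ?thesis
    proof cases
      case 1
      then show ?thesis using coeff_a_Suc_1[OF assms] assms by (simp add: b_def)
    next
      case 2
      then show ?thesis using coeff_a_Suc[of i N] by (auto simp: b_def)
    next
      case 3
      then show ?thesis using coeff_a_diag[OF assms] assms by (simp add: b_def)
    qed
  qed
  have "(\<Sum>i=1..Suc N. coeff_a (Suc N) i * f i) =
      (\<Sum>i=1..Suc N. (2 * of_nat N - of_nat i) * b i * f i) + (\<Sum>i=1..Suc N. b (i - 1) * f i)"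
    by (subst sum.distrib[symmetric], rule sum.cong) (simp_all add: rec algebra_simps)
  also have "(\<Sum>i=1..Suc N. (2 * of_nat N - of_nat i) * b i * f i) =
      (\<Sum>i=1..N. coeff_a N i * ((2 * of_nat N - of_nat i) * f i))"
    by (simp add: b_def mult_ac)
  also have "(\<Sum>i=1..Suc N. b (i - 1) * f i) = (\<Sum>i=0..N. b i * f (Suc i))"
    using sum.shift_bounds_cl_Suc_ivl[of "\<lambda>i. b (i - 1) * f i" 0 N] by simp
  also have "\<dots> = (\<Sum>i=1..N. coeff_a N i * f (Suc i))"
    by (simp add: sum.atLeast_Suc_atMost b_def)
  finally show ?thesis
    by (simp add: sum.distrib distrib_left)
qed

section \<open>Derivatives of \<open>F\<close> with respect to \<open>t\<close>\<close>

lemma F_has_derivative: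
  fixes s x :: "'a::real_normed_field"
  assumes "1 - 2 * s * x + s\<^sup>2 \<noteq> 0"
  shows "((\<lambda>s. F s x) has_field_derivative 2 * (x - s) * (F s x)\<^sup>2) (at s)"
  unfolding F_def using assms
  by (auto intro!: derivative_eq_intros simp: power2_eq_square field_simps)

lemma open_F_domain: "open {s::'a::real_normed_field. 1 - 2 * s * x + s\<^sup>2 \<noteq> 0}"
  by (intro open_Collect_neq continuous_intros)

text \<open>\<open>deriv\<close> is total, so iterating it does not by itself give
  differentiability. A closed form with one polynomial valid on the whole open domain does.\<close>

lemma higher_deriv_F:
  fixes x :: "'a::real_normed_field"
  obtains p where
    "\<And>s. 1 - 2 * s * x + s\<^sup>2 \<noteq> 0 \<Longrightarrow> (deriv ^^ i) (\<lambda>s. F s x) s = poly p s * F s x ^ Suc i"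
proof -
  have "\<exists>p. \<forall>s. 1 - 2 * s * x + s\<^sup>2 \<noteq> 0 \<longrightarrow> (deriv ^^ i) (\<lambda>s. F s x) s = poly p s * F s x ^ Suc i"
  proof (induction i)
    case 0
    show ?case by (rule exI[of _ 1]) simp
  next
    case (Suc i)
    then obtain p where p: "\<And>s. 1 - 2 * s * x + s\<^sup>2 \<noteq> 0 \<Longrightarrow>
      (deriv ^^ i) (\<lambda>s. F s x) s = poly p s * F s x ^ Suc i" by blast
    \<comment> \<open>The product rule leaves one term with \<open>F s x ^ Suc i\<close>;
      multiplying it by \<open>(1 - 2 * s * x + s\<^sup>2) * F s x = 1\<close> raises its power to
      match the other. The two literal polynomials are this quadratic and
      \<open>x - s\<close>.\<close>
    let ?p = "pderiv p * [:1, - 2 * x, 1:] + smult (2 * of_nat (Suc i)) ([:x, -1:] * p)"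
    have "(deriv ^^ Suc i) (\<lambda>s. F s x) s = poly ?p s * F s x ^ Suc (Suc i)"
      if s: "1 - 2 * s * x + s\<^sup>2 \<noteq> 0" for s
    proof -
      have unit: "(1 - 2 * s * x + s\<^sup>2) * F s x = 1"
        using s by (simp add: F_def)
      have "((\<lambda>s. poly p s * F s x ^ Suc i) has_field_derivative
          poly (pderiv p) s * F s x ^ Suc i
          + of_nat (Suc i) * (2 * (x - s) * (F s x)\<^sup>2 * F s x ^ i) * poly p s) (at s)"
        using DERIV_mult[OF poly_DERIV DERIV_power_Suc[OF F_has_derivative[OF s]], of p i]
        by (simp add: mult_ac)
      also have "poly (pderiv p) s * F s x ^ Suc i
          = poly (pderiv p) s * ((1 - 2 * s * x + s\<^sup>2) * F s x) * F s x ^ Suc i"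
        by (simp add: unit)
      also have "\<dots> + of_nat (Suc i) * (2 * (x - s) * (F s x)\<^sup>2 * F s x ^ i) * poly p s
          = poly ?p s * F s x ^ Suc (Suc i)"
        by (simp add: algebra_simps power2_eq_square)
      finally have "((\<lambda>s. poly p s * F s x ^ Suc i) has_field_derivative
          poly ?p s * F s x ^ Suc (Suc i)) (at s)" .
      then have "((deriv ^^ i) (\<lambda>s. F s x) has_field_derivative
          poly ?p s * F s x ^ Suc (Suc i)) (at s)"
        by (rule has_field_derivative_transform_within_open[OF _ open_F_domain[of x]])
          (use s p in auto)
      then show ?thesis by (simp add: DERIV_imp_deriv)
    qed
    then show ?case by blast
  qed
  then show thesis using that by blast
qed

lemma higher_deriv_F_has_derivative:
  fixes s x :: "'a::real_normed_field"
  assumes s: "1 - 2 * s * x + s\<^sup>2 \<noteq> 0"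
  shows "((deriv ^^ i) (\<lambda>s. F s x) has_field_derivative (deriv ^^ Suc i) (\<lambda>s. F s x) s) (at s)"
proof -
  obtain p where p: "\<And>s. 1 - 2 * s * x + s\<^sup>2 \<noteq> 0 \<Longrightarrow>
      (deriv ^^ i) (\<lambda>s. F s x) s = poly p s * F s x ^ Suc i"
    using higher_deriv_F by blast
  obtain D where "((\<lambda>s. poly p s * F s x ^ Suc i) has_field_derivative D) (at s)"
    using DERIV_mult[OF poly_DERIV DERIV_power_Suc[OF F_has_derivative[OF s]]] by blast
  then have "((deriv ^^ i) (\<lambda>s. F s x) has_field_derivative D) (at s)"
    by (rule has_field_derivative_transform_within_open[OF _ open_F_domain[of x]]) (use s p in auto)
  then show ?thesis
    using DERIV_imp_deriv by fastforce
qed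

section \<open>Induction on \<open>N\<close>\<close>

lemma F_power_expansion:
  fixes t x :: "'a::real_normed_field"
  assumes "N \<ge> 1" and "t \<noteq> x" and "1 - 2 * t * x + t\<^sup>2 \<noteq> 0"
  shows "2 ^ N * fact N * F t x ^ Suc N =
    (\<Sum>i=1..N. coeff_a N i * ((x - t) powi (int i - 2 * int N) * (deriv ^^ i) (\<lambda>s. F s x) t))"
  using assms
\<comment> \<open>The point \<open>t\<close> stays arbitrary because differentiating the identity
  requires it in a whole neighbourhood.\<close>
proof (induction N arbitrary: t rule: nat_induct_at_least)
  case base
  then have "deriv (\<lambda>s. F s x) t = 2 * (x - t) * (F t x)\<^sup>2"
    by (intro DERIV_imp_deriv F_has_derivative)
  moreover have "inverse (x - t) * (2 * x - 2 * t) = 2" using base by (simp add: field_simps)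
  ultimately show ?case
    by (simp add: coeff_a_def odd_double_fact_def power_int_minus power2_eq_square mult.assoc[symmetric])
next
  case (Suc N)
  let ?D = "\<lambda>i. (deriv ^^ i) (\<lambda>s. F s x)"
  let ?U = "{s. s \<noteq> x} \<inter> {s. 1 - 2 * s * x + s\<^sup>2 \<noteq> 0}"
  let ?L = "2 ^ N * fact N * (of_nat (Suc N) * (2 * (x - t) * (F t x)\<^sup>2 * F t x ^ N))"
  let ?R = "\<Sum>i=1..N. coeff_a N i * ((2 * of_nat N - of_nat i)
      * (x - t) powi (int i - 2 * int N - 1) * ?D i t + (x - t) powi (int i - 2 * int N) * ?D (Suc i) t)"
  have "open ?U"
    by (intro open_Int open_F_domain open_Collect_neq continuous_intros)
  have "((\<lambda>s. 2 ^ N * fact N * F s x ^ Suc N) has_field_derivative ?L) (at t)"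
    using DERIV_cmult[OF DERIV_power_Suc[OF F_has_derivative[OF Suc.prems(2)]], of "2 ^ N * fact N" N]
    by simp
  moreover have "((\<lambda>s. 2 ^ N * fact N * F s x ^ Suc N) has_field_derivative ?R) (at t)"
  proof (rule has_field_derivative_transform_within_open[OF _ \<open>open ?U\<close>])
    show "((\<lambda>s. \<Sum>i=1..N. coeff_a N i * ((x - s) powi (int i - 2 * int N) * ?D i s))
        has_field_derivative ?R) (at t)"
    proof (intro DERIV_sum DERIV_cmult)
      fix i
      \<comment> \<open>The inner derivative -1 turns the exponent \<open>i - 2 * N\<close> into the
        factor \<open>2 * N - i\<close> of the recurrence.\<close>
      have "((\<lambda>s. (x - s) powi (int i - 2 * int N)) has_field_derivative
          of_int (int i - 2 * int N) * (x - t) powi (int i - 2 * int N - 1) * (0 - 1)) (at t)"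
        using Suc.prems by (intro DERIV_power_int DERIV_diff DERIV_const DERIV_ident) auto
      from DERIV_mult[OF this higher_deriv_F_has_derivative[OF Suc.prems(2), of i]]
      show "((\<lambda>s. (x - s) powi (int i - 2 * int N) * ?D i s) has_field_derivative
        (2 * of_nat N - of_nat i) * (x - t) powi (int i - 2 * int N - 1) * ?D i t
          + (x - t) powi (int i - 2 * int N) * ?D (Suc i) t) (at t)"
        by (rule DERIV_cong) (simp add: algebra_simps)
    qed
  qed (use Suc in auto)
  ultimately have LR: "?L = ?R"
    by (rule DERIV_unique)
  have nz: "x - t \<noteq> 0" using Suc.prems by simp
  have "(x - t) * (2 ^ Suc N * fact (Suc N) * F t x ^ Suc (Suc N)) = ?L"
    by (simp add: power2_eq_square algebra_simps)
  also have "\<dots> = (x - t) * (\<Sum>i=1..N. coeff_a N i * ((2 * of_nat N - of_nat i)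
      * ((x - t) powi (int i - 2 * int (Suc N)) * ?D i t)
      + (x - t) powi (int (Suc i) - 2 * int (Suc N)) * ?D (Suc i) t))"
  proof -
    \<comment> \<open>Both exponents are one larger than those wanted for \<open>Suc N\<close>, so a
      common factor \<open>x - t\<close> can be cancelled at the end.\<close>
    have powi: "(x - t) powi (int i - 2 * int N - 1) = (x - t) * (x - t) powi (int i - 2 * int (Suc N))"
      "(x - t) powi (int i - 2 * int N) = (x - t) * (x - t) powi (int (Suc i) - 2 * int (Suc N))" for i
      using power_int_add_1'[OF disjI1[OF nz], of "int i - 2 * int (Suc N)"]
        power_int_add_1'[OF disjI1[OF nz], of "int (Suc i) - 2 * int (Suc N)"]
      by (simp_all add: algebra_simps)
    show ?thesis
      unfolding LR sum_distrib_left powi by (intro sum.cong refl) (simp only: distrib_left mult_ac)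
  qed
  also have "\<dots> = (x - t) * (\<Sum>i=1..Suc N. coeff_a (Suc N) i
      * ((x - t) powi (int i - 2 * int (Suc N)) * ?D i t))"
    using Suc.hyps by (subst sum_coeff_a_Suc) auto
  finally show ?case
    using nz by simp
qed

text \<open>The differentiability conjunct ensures that the iterates of \<open>deriv\<close> are
  genuine derivatives and not default values. The type covers both the real and the complex
  case.\<close>

theorem theorem1:
  fixes N :: nat and t x :: "'a::real_normed_field"
  assumes "N \<ge> 1" and "t \<noteq> x" and "1 - 2 * t * x + t\<^sup>2 \<noteq> 0"
  shows "(\<forall>i<N. (deriv ^^ i) (\<lambda>s. F s x) field_differentiable at t) \<and>
    2 ^ N * fact N * F t x ^ (N + 1) =
      (\<Sum>i=1..N. coeff_a N i * (x - t) powi (int i - 2 * int N)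
                   * (deriv ^^ i) (\<lambda>s. F s x) t)"
  using higher_deriv_F_has_derivative[OF assms(3)] F_power_expansion[OF assms]
  by (auto simp: field_differentiable_def mult.assoc)

end
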